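(* Let $D_n$ be a maximal Diophantine graph of order $n$ with Diophantine labelling $f$, and let $u$ be a vertex of $D_n$. If $f^*(u)=\prod_{i=1}^{r}p_i^{k_i}$, where $p_1,\dots,p_r$ are distinct prime numbers and $k_i\in\mathbb{N}$ for $i=1,2,\dots,r$, then $$\deg(u)=n-1\quad\text{if } f^*(u)=1,$$ and $$\deg(u)=n-\sum_{1\leq i\leq r}\left\lfloor\frac{n}{p_i^{\acute{v}_{p_i}(n)}}\right\rfloor+\sum_{1\leq i<j\leq r}\left\lfloor\frac{n}{p_i^{\acute{v}_{p_i}(n)}p_j^{\acute{v}_{p_j}(n)}}\right\rfloor-\dots +(-1)^{r}\left\lfloor\frac{n}{\prod_{1\leq i\leq r}p_i^{\acute{v}_{p_i}(n)}}\right\rfloor\quad\text{if } f^*(u)>1.$$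
   Context: All graphs are finite, simple and undirected, and $(a,b)$ denotes the greatest common divisor of $a$ and $b$. A graph $G=(V,E)$ of order $n$ is a Diophantine graph if there is a bijection $f:V\to\{1,2,\dots,n\}$ (a Diophantine labelling) such that $(f(u),f(v))\mid n$ for all $uv\in E$. It is a maximal Diophantine graph, denoted $(D_n,f)$ or simply $D_n$, if adding any new edge turns it into a non-Diophantine graph; two distinct vertices $u,v$ of $D_n$ are adjacent if and only if $(f(u),f(v))\mid n$. The reduced label of a vertex $u$ is $f^*(u):=\frac{f(u)}{(f(u),n)}$. For a prime $p$, $v_p(n)$ is the $p$-adic valuation of $n$ (the $t$ with $p^t\mid n$ and $p^{t+1}\nmid n$), and $\acute{v}_p(n):=v_p(n)+1$. Here $\mathbb{N}=\mathbb{Z}^+\cup\{0\}$, the set of nonnegative integers. The dots stand for the usual inclusion-exclusion terms over all subsets of $\{p_1,\dots,p_r\}$.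
   Formalization: In the case f*(u)>1 the exponents k_i are required to be positive; with some k_i=0 the formula fails, e.g. n=5, f(u)=2=2^1·3^0 has degree 3 while the formula gives 2. *)

theory Defs
  imports Complex_Main "HOL-Computational_Algebra.Primes" "Graph_Theory.Pair_Digraph"
begin

text \<open>
  A finite simple undirected graph is a \<^locale>\<open>pair_graph\<close>: a finite set of vertices with an
  irreflexive symmetric set of arcs, where the edge \<open>uv\<close> is the pair of arcs \<open>(u, v)\<close>, \<open>(v, u)\<close>.
  Hence the degree of a vertex is its out-degree.
\<close>

definition order :: "'a pair_pre_digraph \<Rightarrow> nat" where
  "order G = card (pverts G)"

definition vertex_degree :: "'a pair_pre_digraph \<Rightarrow> 'a \<Rightarrow> nat" where
  "vertex_degree G u = out_degree (with_proj G) u"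

definition add_edge :: "'a \<Rightarrow> 'a \<Rightarrow> 'a pair_pre_digraph \<Rightarrow> 'a pair_pre_digraph" where
  "add_edge u v G = G\<lparr>parcs := parcs G \<union> {(u, v), (v, u)}\<rparr>"

definition diophantine_labelling :: "'a pair_pre_digraph \<Rightarrow> ('a \<Rightarrow> nat) \<Rightarrow> bool" where
  "diophantine_labelling G f \<longleftrightarrow>
     bij_betw f (pverts G) {1..order G} \<and>
     (\<forall>(u, v) \<in> parcs G. gcd (f u) (f v) dvd order G)"

definition diophantine_graph :: "'a pair_pre_digraph \<Rightarrow> bool" where
  "diophantine_graph G \<longleftrightarrow> pair_graph G \<and> (\<exists>f. diophantine_labelling G f)"

definition maximal_diophantine_graph :: "'a pair_pre_digraph \<Rightarrow> bool" where
  "maximal_diophantine_graph G \<longleftrightarrow>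
     diophantine_graph G \<and>
     (\<forall>u \<in> pverts G. \<forall>v \<in> pverts G.
        u \<noteq> v \<and> (u, v) \<notin> parcs G \<longrightarrow> \<not> diophantine_graph (add_edge u v G))"

definition reduced_label :: "'a pair_pre_digraph \<Rightarrow> ('a \<Rightarrow> nat) \<Rightarrow> 'a \<Rightarrow> nat" where
  "reduced_label G f u = f u div gcd (f u) (order G)"

definition succ_valuation :: "nat \<Rightarrow> nat \<Rightarrow> nat" where
  "succ_valuation p n = multiplicity p n + 1"

text \<open>
  Adding a new edge yields a graph again, so in \<^const>\<open>maximal_diophantine_graph\<close> it is the
  labelling condition that has to fail.
\<close>

lemma pair_graph_add_edge:
  assumes "pair_graph G" "u \<in> pverts G" "v \<in> pverts G" "u \<noteq> v"
  shows "pair_graph (add_edge u v G)"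
proof -
  interpret pair_graph G by fact
  have "sym (parcs G)"
    using pair_sym_arcs by (simp add: symmetric_def)
  then have "sym (parcs G \<union> {(u, v), (v, u)})"
    by (auto simp: sym_def)
  with assms show ?thesis
    by unfold_locales
       (auto simp: add_edge_def symmetric_def dest: wellformed' pair_no_loops
             intro: pair_finite_verts pair_finite_arcs)
qed

lemma maximal_diophantine_adjacent_iff:
  assumes max: "maximal_diophantine_graph G" and lab: "diophantine_labelling G f"
    and uv: "u \<in> pverts G" "v \<in> pverts G" "u \<noteq> v"
  shows "(u, v) \<in> parcs G \<longleftrightarrow> gcd (f u) (f v) dvd order G"
proof
  assume "(u, v) \<in> parcs G"
  then show "gcd (f u) (f v) dvd order G"
    using lab by (auto simp: diophantine_labelling_def)
next
  assume dvd: "gcd (f u) (f v) dvd order G"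
  have "diophantine_labelling (add_edge u v G) f"
    using lab dvd
    by (auto simp: diophantine_labelling_def add_edge_def order_def gcd.commute)
  moreover have "pair_graph (add_edge u v G)"
    using max uv
    by (auto simp: maximal_diophantine_graph_def diophantine_graph_def intro: pair_graph_add_edge)
  ultimately show "(u, v) \<in> parcs G"
    using max uv by (auto simp: maximal_diophantine_graph_def diophantine_graph_def)
qed

end

theory Submission
  imports Defs
begin

text \<open>
  For positive integers, \<open>a\<close> divides \<open>n\<close> unless some prime power \<open>p ^ (v\<^sub>p(n) + 1)\<close> divides \<open>a\<close>.
  Hence \<open>u\<close> and \<open>v\<close> are non-adjacent iff some \<open>p ^ (v\<^sub>p(n) + 1)\<close> divides both labels, and it
  divides \<open>f(u)\<close> exactly when \<open>p\<close> divides the reduced label of \<open>u\<close>. The neighbours of \<open>u\<close>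
  therefore correspond to the labels that avoid all multiples of \<open>p\<^sub>i ^ (v(n) + 1)\<close> for the
  prime factors \<open>p\<^sub>i\<close> of the reduced label. These moduli are pairwise coprime, so the
  sieve formula counts the labels.
\<close>

lemma card_multiples_atLeastAtMost:
  "card {x \<in> {1..n}. d dvd x} = n div (d::nat)"
proof (cases "d = 0")
  \<comment> \<open>No positive number is a multiple of 0, which agrees with the convention
    \<open>n div 0 = 0\<close>.\<close>
  case True
  then show ?thesis by auto
next
  case False
  have "{x \<in> {1..n}. d dvd x} = (*) d ` {1..n div d}"
  proof (intro equalityI subsetI)
    fix x assume "x \<in> {x \<in> {1..n}. d dvd x}"
    then obtain y where "x = d * y" "1 \<le> d * y" "d * y \<le> n" by auto
    then have "y \<in> {1..n div d}"
      using False by (simp add: less_eq_div_iff_mult_less_eq mult.commute)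
    with \<open>x = d * y\<close> show "x \<in> (*) d ` {1..n div d}" by blast
  next
    fix x assume "x \<in> (*) d ` {1..n div d}"
    then show "x \<in> {x \<in> {1..n}. d dvd x}"
      using False by (auto simp: less_eq_div_iff_mult_less_eq mult.commute)
  qed
  then show ?thesis
    using False by (simp add: card_image inj_on_def)
qed

lemma prod_dvd_iff_pairwise_coprime:
  fixes q :: "'i \<Rightarrow> 'a::semiring_gcd"
  assumes "finite S" and "\<And>i j. i \<in> S \<Longrightarrow> j \<in> S \<Longrightarrow> i \<noteq> j \<Longrightarrow> coprime (q i) (q j)"
  shows "(\<Prod>i\<in>S. q i) dvd x \<longleftrightarrow> (\<forall>i\<in>S. q i dvd x)"
  using assms
proof (induction S rule: finite_induct)
  case (insert i S)
  have "coprime (q i) (\<Prod>j\<in>S. q j)"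
    using insert.hyps insert.prems by (intro prod_coprime_right) auto
  then have "q i * (\<Prod>j\<in>S. q j) dvd x \<longleftrightarrow> q i dvd x \<and> (\<Prod>j\<in>S. q j) dvd x"
    by (auto intro: divides_mult dest: dvd_mult_left dvd_mult_right)
  then show ?case
    using insert by simp
qed simp

text \<open>Inclusion-exclusion by indicators: the product of \<open>1 - of_bool (q i dvd x)\<close>
  over \<open>I\<close> is expanded and summed over \<open>x\<close>. Coprimality merges the
  conditions \<open>q i dvd x\<close> for \<open>i\<close> in \<open>S\<close> into divisibility by
  one product, whose multiples are easy to count.\<close>

lemma card_not_dvd_pairwise_coprime:
  fixes q :: "'i \<Rightarrow> nat"
  assumes fin: "finite I"
    and cop: "\<And>i j. i \<in> I \<Longrightarrow> j \<in> I \<Longrightarrow> i \<noteq> j \<Longrightarrow> coprime (q i) (q j)"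
  shows "int (card {x \<in> {1..n}. \<forall>i\<in>I. \<not> q i dvd x}) =
    (\<Sum>S\<in>Pow I. (-1) ^ card S * int (n div (\<Prod>i\<in>S. q i)))"
proof -
  have ind: "(\<Prod>i\<in>S. of_bool (P i)) = (of_bool (\<forall>i\<in>S. P i) :: int)" if "finite S" for S :: "'i set" and P
    using that by (induction S rule: finite_induct) auto
  have "int (card {x \<in> {1..n}. \<forall>i\<in>I. \<not> q i dvd x}) =
      (\<Sum>x\<in>{1..n}. of_bool (\<forall>i\<in>I. \<not> q i dvd x))"
    by (simp add: Int_def)
  also have "\<dots> = (\<Sum>x\<in>{1..n}. \<Prod>i\<in>I. 1 - of_bool (q i dvd x))"
    by (simp add: fin flip: ind of_bool_not_iff)
  also have "\<dots> = (\<Sum>x\<in>{1..n}. \<Sum>S\<in>Pow I. (-1) ^ card S * of_bool ((\<Prod>i\<in>S. q i) dvd x))"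
  proof (intro sum.cong refl)
    fix x
    \<comment> \<open>Here \<open>S\<close> collects the factors that contribute their indicator;
      the factors in \<open>I - S\<close> contribute the 1.\<close>
    have "(\<Prod>i\<in>I. 1 - of_bool (q i dvd x)) =
        (\<Sum>S\<in>Pow I. (-1) ^ card S * (\<Prod>i\<in>S. of_bool (q i dvd x)) * (\<Prod>i\<in>I - S. 1) :: int)"
      by (rule prod_diff_conv_sum) fact
    also have "\<dots> = (\<Sum>S\<in>Pow I. (-1) ^ card S * of_bool ((\<Prod>i\<in>S. q i) dvd x))"
    proof (intro sum.cong refl)
      fix S assume "S \<in> Pow I"
      then have "finite S" using fin by (auto intro: finite_subset)
      moreover have "(\<Prod>i\<in>S. q i) dvd x \<longleftrightarrow> (\<forall>i\<in>S. q i dvd x)"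
        using \<open>S \<in> Pow I\<close> \<open>finite S\<close> cop by (intro prod_dvd_iff_pairwise_coprime) auto
      ultimately show "(-1) ^ card S * (\<Prod>i\<in>S. of_bool (q i dvd x)) * (\<Prod>i\<in>I - S. 1) =
          (-1) ^ card S * (of_bool ((\<Prod>i\<in>S. q i) dvd x) :: int)"
        by (simp add: ind)
    qed
    finally show "(\<Prod>i\<in>I. 1 - of_bool (q i dvd x)) =
      (\<Sum>S\<in>Pow I. (-1) ^ card S * (of_bool ((\<Prod>i\<in>S. q i) dvd x) :: int))" .
  qed
  also have "\<dots> = (\<Sum>S\<in>Pow I. (-1) ^ card S * (\<Sum>x\<in>{1..n}. of_bool ((\<Prod>i\<in>S. q i) dvd x)))"
    by (subst sum.swap) (simp only: sum_distrib_left)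
  also have "\<dots> = (\<Sum>S\<in>Pow I. (-1) ^ card S * int (n div (\<Prod>i\<in>S. q i)))"
    by (simp add: Int_def flip: card_multiples_atLeastAtMost)
  finally show ?thesis .
qed

lemma prime_power_Suc_multiplicity_not_dvd:
  fixes n p :: nat
  assumes "prime p" "n > 0"
  shows "\<not> p ^ Suc (multiplicity p n) dvd n"
  using assms multiplicity_geI[of n p "Suc (multiplicity p n)"] not_prime_unit by fastforce

text \<open>Write \<open>a = g * a'\<close> and \<open>n = g * n'\<close> with \<open>a'\<close>,
  \<open>n'\<close> coprime. If \<open>p\<close> divides \<open>a'\<close>, it does not divide
  \<open>n'\<close>, so \<open>g\<close> carries the full power of \<open>p\<close> in
  \<open>n\<close> and \<open>a'\<close> adds one more factor \<open>p\<close>. If \<open>p\<close>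
  does not divide \<open>a'\<close>, a power of \<open>p\<close> dividing \<open>a\<close> already
  divides \<open>g\<close>, hence \<open>n\<close>, so its exponent is at most
  \<open>multiplicity p n\<close>.\<close>

lemma prime_dvd_div_gcd_iff:
  fixes a n p :: nat
  assumes "prime p" "a > 0" "n > 0"
  shows "p dvd a div gcd a n \<longleftrightarrow> p ^ Suc (multiplicity p n) dvd a"
proof -
  define g where "g = gcd a n"
  obtain a' n' where a: "a = g * a'" and n: "n = g * n'"
    unfolding g_def by (meson dvdE gcd_dvd1 gcd_dvd2)
  have g: "g > 0" using assms by (simp add: g_def)
  have "coprime a' n'"
    using div_gcd_coprime[of a n] assms g
    by (metis a n g_def neq0_conv nonzero_mult_div_cancel_left)
  have "p dvd a' \<longleftrightarrow> p ^ Suc (multiplicity p n) dvd g * a'"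
  proof
    assume p: "p dvd a'"
    then have "\<not> p dvd n'"
      using \<open>coprime a' n'\<close> \<open>prime p\<close> by (meson coprime_common_divisor not_prime_unit)
    then have "multiplicity p n = multiplicity p g"
      using assms g n
      by (simp add: prime_elem_multiplicity_mult_distrib not_dvd_imp_multiplicity_0)
    then show "p ^ Suc (multiplicity p n) dvd g * a'"
      using p by (simp add: mult_dvd_mono multiplicity_dvd mult.commute[of p])
  next
    assume dvd: "p ^ Suc (multiplicity p n) dvd g * a'"
    show "p dvd a'"
    proof (rule ccontr)
      assume "\<not> p dvd a'"
      then have "coprime (p ^ Suc (multiplicity p n)) a'"
        using \<open>prime p\<close> by (intro coprime_power_left_iff[THEN iffD2] disjI1 prime_imp_coprime)
      with dvd have "p ^ Suc (multiplicity p n) dvd n"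
        by (metis coprime_dvd_mult_left_iff dvd_mult2 n)
      then show False
        using assms \<open>prime p\<close> prime_power_Suc_multiplicity_not_dvd by blast
    qed
  qed
  then show ?thesis
    unfolding g_def[symmetric] using g by (simp add: a)
qed

lemma not_dvd_iff_prime_power:
  fixes a n :: nat
  assumes "a > 0" "n > 0"
  shows "\<not> a dvd n \<longleftrightarrow> (\<exists>p. prime p \<and> p ^ Suc (multiplicity p n) dvd a)"
proof
  assume "\<not> a dvd n"
  then obtain p where "prime p" "multiplicity p n < multiplicity p a"
    using assms multiplicity_le_imp_dvd[of a n] by (metis not_less not_gr_zero)
  then show "\<exists>p. prime p \<and> p ^ Suc (multiplicity p n) dvd a"
    using multiplicity_dvd' Suc_leI by blast
next
  assume "\<exists>p. prime p \<and> p ^ Suc (multiplicity p n) dvd a"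
  then obtain p where "prime p" and p: "p ^ Suc (multiplicity p n) dvd a" by blast
  then have "\<not> p ^ Suc (multiplicity p n) dvd n"
    using assms \<open>prime p\<close> prime_power_Suc_multiplicity_not_dvd by blast
  with p show "\<not> a dvd n" by (meson dvd_trans)
qed

text \<open>A prime power divides \<open>gcd a x\<close> iff it divides both \<open>a\<close> and
  \<open>x\<close>. Expressing its divisibility of \<open>a\<close> through the reduced label makes
  the set of relevant primes independent of \<open>x\<close>, which prepares the sieve.\<close>

lemma gcd_dvd_iff_prime_power:
  fixes a x n :: nat
  assumes "a > 0" "n > 0"
  shows "gcd a x dvd n \<longleftrightarrow>
    (\<forall>p. prime p \<and> p dvd a div gcd a n \<longrightarrow> \<not> p ^ Suc (multiplicity p n) dvd x)"
  using assms not_dvd_iff_prime_power[of "gcd a x" n]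
  by (auto simp: prime_dvd_div_gcd_iff simp del: power_Suc)

text \<open>By maximality the gcd condition decides adjacency, and the bijection \<open>f\<close>
  carries the neighbours to their labels. The label \<open>f u\<close> is removed because there are
  no loops, although it meets the gcd condition when it divides the order.\<close>

lemma vertex_degree_eq_card_labels:
  assumes max: "maximal_diophantine_graph G" and lab: "diophantine_labelling G f"
    and u: "u \<in> pverts G"
  shows "vertex_degree G u = card ({x \<in> {1..order G}. gcd (f u) x dvd order G} - {f u})"
proof -
  interpret pair_graph G
    using max by (simp add: maximal_diophantine_graph_def diophantine_graph_def)
  have bij: "bij_betw f (pverts G) {1..order G}"
    using lab by (simp add: diophantine_labelling_def)
  let ?N = "{v \<in> pverts G. v \<noteq> u \<and> gcd (f u) (f v) dvd order G}"
  have "out_arcs (with_proj G) u = Pair u ` ?N"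
  proof (intro equalityI subsetI)
    fix e assume "e \<in> out_arcs (with_proj G) u"
    then obtain v where e: "e = (u, v)" "(u, v) \<in> parcs G"
      by (cases e) (auto simp: out_arcs_def)
    then have "v \<in> pverts G" "v \<noteq> u"
      using in_arcsD2 no_loops' by auto
    then show "e \<in> Pair u ` ?N"
      using e maximal_diophantine_adjacent_iff[OF max lab u] by auto
  next
    fix e assume "e \<in> Pair u ` ?N"
    then show "e \<in> out_arcs (with_proj G) u"
      using maximal_diophantine_adjacent_iff[OF max lab u] by (auto simp: out_arcs_def)
  qed
  then have "vertex_degree G u = card ?N"
    by (simp add: vertex_degree_def out_degree_def card_image inj_on_def)
  also have "\<dots> = card (f ` ?N)"
    using bij by (intro card_image[symmetric]) (auto simp: bij_betw_def inj_on_def)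
  also have "f ` ?N = {x \<in> {1..order G}. gcd (f u) x dvd order G} - {f u}"
  proof (intro equalityI subsetI)
    fix x assume "x \<in> f ` ?N"
    then show "x \<in> {x \<in> {1..order G}. gcd (f u) x dvd order G} - {f u}"
      using bij u bij_betwE[OF bij] by (auto simp: bij_betw_def inj_on_eq_iff)
  next
    fix x assume x: "x \<in> {x \<in> {1..order G}. gcd (f u) x dvd order G} - {f u}"
    then have "x \<in> f ` pverts G"
      using bij by (auto simp: bij_betw_def)
    then obtain v where "v \<in> pverts G" "x = f v" by blast
    with x show "x \<in> f ` ?N" by auto
  qed
  finally show ?thesis .
qed

text \<open>Grouping the subsets by cardinality gives the alternating sum its usual layered form,
  with the term of the empty set split off as the leading one.\<close>

lemma sum_Pow_eq_sum_card:
  fixes h :: "'i set \<Rightarrow> 'b::comm_ring_1"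
  assumes "finite I"
  shows "(\<Sum>S\<in>Pow I. (-1) ^ card S * h S) =
    h {} + (\<Sum>m = 1..card I. (-1) ^ m * (\<Sum>S | S \<subseteq> I \<and> card S = m. h S))"
proof -
  have "(\<Sum>S\<in>Pow I. (-1) ^ card S * h S) =
      (\<Sum>m = 0..card I. \<Sum>S | S \<in> Pow I \<and> card S = m. (-1) ^ card S * h S)"
    using assms by (intro sum.group[symmetric]) (auto intro: card_mono)
  also have "\<dots> = (\<Sum>m = 0..card I. (-1) ^ m * (\<Sum>S | S \<subseteq> I \<and> card S = m. h S))"
    by (intro sum.cong refl) (auto simp: sum_distrib_left)
  also have "\<dots> = (\<Sum>S | S \<subseteq> I \<and> card S = 0. h S) +
      (\<Sum>m = 1..card I. (-1) ^ m * (\<Sum>S | S \<subseteq> I \<and> card S = m. h S))"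
    by (simp add: sum.atLeast_Suc_atMost)
  \<comment> \<open>Finiteness of \<open>I\<close> matters: infinite sets have \<open>card\<close> 0
    as well.\<close>
  also have "{S. S \<subseteq> I \<and> card S = 0} = {{}}"
    using assms by (auto dest: finite_subset)
  finally show ?thesis by simp
qed

text \<open>Positive exponents make \<open>p 1\<close>, ..., \<open>p r\<close> exactly the prime
  factors of the reduced label; a prime with exponent 0 could make the sieve discard labels of
  neighbours.\<close>

theorem theorem4p3:
  fixes G :: "'a pair_pre_digraph" and f :: "'a \<Rightarrow> nat" and u :: 'a
    and n r :: nat and p k :: "nat \<Rightarrow> nat"
  assumes "maximal_diophantine_graph G"
    and "order G = n"
    and "diophantine_labelling G f"
    and "u \<in> pverts G"
    and "\<forall>i \<in> {1..r}. prime (p i)"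
    and "inj_on p {1..r}"
    and "reduced_label G f u = (\<Prod>i = 1..r. p i ^ k i)"
  shows "(reduced_label G f u = 1 \<longrightarrow> vertex_degree G u = n - 1) \<and>
    (reduced_label G f u > 1 \<and> (\<forall>i \<in> {1..r}. k i > 0) \<longrightarrow>
      int (vertex_degree G u) =
        int n + (\<Sum>m = 1..r. (-1) ^ m *
          (\<Sum>S | S \<subseteq> {1..r} \<and> card S = m.
             \<lfloor>real n / real (\<Prod>i\<in>S. p i ^ succ_valuation (p i) n)\<rfloor>)))"
proof -
  define L where "L = {x \<in> {1..n}. gcd (f u) x dvd n}"
  have fu: "f u \<in> {1..n}"
    using assms(2-4) by (auto simp: diophantine_labelling_def dest: bij_betwE)
  then have pos: "f u > 0" "n > 0" by auto
  have deg: "vertex_degree G u = card (L - {f u})"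
    using vertex_degree_eq_card_labels[OF assms(1,3,4)] assms(2) by (simp add: L_def)
  have red: "reduced_label G f u = f u div gcd (f u) n"
    by (simp add: reduced_label_def assms(2))
  have L: "L = {x \<in> {1..n}. \<forall>q. prime q \<and> q dvd reduced_label G f u \<longrightarrow>
      \<not> q ^ Suc (multiplicity q n) dvd x}"
    using gcd_dvd_iff_prime_power[OF pos] by (simp add: L_def red)
  show ?thesis
  proof (intro conjI impI)
    assume "reduced_label G f u = 1"
    \<comment> \<open>No prime divides 1, so every label passes; \<open>f u\<close> itself is then
      subtracted.\<close>
    then have "L = {1..n}" by (auto simp: L simp del: power_Suc)
    then show "vertex_degree G u = n - 1" using fu by (simp add: deg)
  next
    assume *: "reduced_label G f u > 1 \<and> (\<forall>i \<in> {1..r}. k i > 0)"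
    define q where "q i = p i ^ succ_valuation (p i) n" for i
    \<comment> \<open>The sieve already discards \<open>f u\<close>, so the formula starts from
      \<open>n\<close> and not from \<open>n - 1\<close>.\<close>
    have "f u \<notin> L"
    proof
      assume "f u \<in> L"
      then have "gcd (f u) n = f u" by (simp add: L_def gcd_nat.absorb1)
      with pos have "reduced_label G f u = 1" by (simp add: red)
      with * show False by simp
    qed
    have factors: "prime s \<and> s dvd reduced_label G f u \<longleftrightarrow> s \<in> p ` {1..r}" for s
    proof
      assume s: "prime s \<and> s dvd reduced_label G f u"
      then obtain i where "i \<in> {1..r}" "s dvd p i ^ k i"
        using assms(7) by (auto simp: prime_dvd_prod_iff)
      then show "s \<in> p ` {1..r}"
        using s assms(5) by (metis imageI prime_dvd_power primes_dvd_imp_eq)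
    next
      assume "s \<in> p ` {1..r}"
      then obtain i where i: "i \<in> {1..r}" "s = p i" by blast
      then have "p i dvd p i ^ k i" using * by (simp add: dvd_power)
      also have "\<dots> dvd reduced_label G f u"
        unfolding assms(7) using i by (intro dvd_prodI) auto
      finally show "prime s \<and> s dvd reduced_label G f u" using i assms(5) by simp
    qed
    have L_sieve: "L = {x \<in> {1..n}. \<forall>i\<in>{1..r}. \<not> q i dvd x}"
      by (simp add: L factors q_def succ_valuation_def Ball_def[symmetric] del: power_Suc)
    have "coprime (q i) (q j)" if "i \<in> {1..r}" "j \<in> {1..r}" "i \<noteq> j" for i j
    proof -
      have "p i \<noteq> p j" using that assms(6) by (meson inj_onD)
      then show ?thesis
        using that assms(5) primes_coprime[of "p i" "p j"] by (simp add: q_def)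
    qed
    then have "int (card L) = (\<Sum>S\<in>Pow {1..r}. (-1) ^ card S * int (n div (\<Prod>i\<in>S. q i)))"
      unfolding L_sieve by (intro card_not_dvd_pairwise_coprime) auto
    also have "\<dots> = int n + (\<Sum>m = 1..r. (-1) ^ m *
        (\<Sum>S | S \<subseteq> {1..r} \<and> card S = m. int (n div (\<Prod>i\<in>S. q i))))"
      by (subst sum_Pow_eq_sum_card) simp_all
    \<comment> \<open>The floor of the real quotient is the natural-number quotient;
      \<open>of_nat_prod\<close> is switched off so that the denominator stays the image of a single
      natural number.\<close>
    finally show "int (vertex_degree G u) =
        int n + (\<Sum>m = 1..r. (-1) ^ m *
          (\<Sum>S | S \<subseteq> {1..r} \<and> card S = m.
             \<lfloor>real n / real (\<Prod>i\<in>S. p i ^ succ_valuation (p i) n)\<rfloor>))"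
      using \<open>f u \<notin> L\<close> by (simp add: deg q_def floor_divide_of_nat_eq del: of_nat_prod)
  qed
qed

end
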